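(* Let $\mathcal C$ be a finite forest category in which the monoid $\mathrm{Obj}(\mathcal C)$ is idempotent and commutative. Then $\mathcal C$ is globally idempotent and commutative if and only if the following three conditions hold: (i) (Loop removal) for all objects $y,z_1,z_2$, all $r\in\mathrm{HArr}(y)$, $s\in\mathrm{Arr}(y,y)$, $t_1\in\mathrm{Arr}(y,z_1)$, $t_2\in\mathrm{Arr}(y,z_2)$: $\;rst_1+rst_2=rt_1+rst_2$; (ii) (Horizontal absorption) for all objects $x,y,z,z'$, all $r\in\mathrm{HArr}(x)$, $s\in\mathrm{HArr}(x+y)$, $t\in\mathrm{Arr}(x+y,z)$, $u\in\mathrm{Arr}(x,z')$: $\;(r+s)t+ru=st+ru$ (note $r+s\in\mathrm{HArr}(x+y)$ since $x+x=x$); (iii) (Horizontal idempotence) for every half-arrow $r$: $\;r=r+r$.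
   Context: Forest algebras. A forest algebra $(H,V)$ consists of a commutative monoid $H$ (additive, identity $0$), a monoid $V$, and a faithful right action $H\times V\to H$ such that for $v\in V$, $h\in H$ there is $v+h\in V$ with $g(v+h)=gv+h$ for all $g\in H$. If $H$ is an idempotent commutative monoid, $H$ acting on itself by $hv=h+v$ gives a forest algebra $(H,H)$, called a flat idempotent and commutative forest algebra. Forest categories. A forest category $\mathcal C$ consists of: a finite set $\mathrm{Obj}(\mathcal C)$ which is a commutative monoid under $+$ with identity $0$; for all objects $x,y$ a set $\mathrm{Arr}(x,y)$ of arrows (pairwise disjoint); for each object $x$ a set $\mathrm{HArr}(x)$ of half-arrows to $x$ (pairwise disjoint), subject to: (1) the set of all half-arrows is a commutative monoid under $+$ with $\mathrm{HArr}(x)+\mathrm{HArr}(y)\subseteq\mathrm{HArr}(x+y)$, the end map being a homomorphism onto $\mathrm{Obj}(\mathcal C)$; (2) an associative composition $\mathrm{Arr}(x,y)\times\mathrm{Arr}(y,z)\to\mathrm{Arr}(x,z)$, $(u,v)\mapsto uv$, with identity arrows $1_x$; (3) an action $\mathrm{HArr}(x)\times\mathrm{Arr}(x,y)\to\mathrm{HArr}(y)$, $(c,u)\mapsto cu$, with $(cu)v=c(uv)$, $c1_x=c$, faithful (if $cu=cu'$ for all $c\in\mathrm{HArr}(x)$ then $u=u'$); (4) for $u\in\mathrm{Arr}(x,y)$, $c\in\mathrm{HArr}(z)$ an arrow $u+c\in\mathrm{Arr}(x,y+z)$ with $f(u+c)=(fu)+c$ for all $f\in\mathrm{Arr}(w,x)$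 and $(u+c)+d=u+(c+d)$. Expressions such as $rst_1$ denote $((rs)t_1)$ via the action, and sums of half-arrows use the monoid $+$. Division. $\mathcal C\prec(H,V)$ means: there are nonempty sets $K_c\subseteq H$ for each half-arrow $c$ and $K_u\subseteq V$ for each arrow $u$ with $K_uK_v\subseteq K_{uv}$, $K_cK_u\subseteq K_{cu}$, $K_c+K_d\subseteq K_{c+d}$, $K_u+K_c\subseteq K_{u+c}$ whenever defined, and distinct arrows in the same $\mathrm{Arr}(x,y)$ (resp. distinct half-arrows in the same $\mathrm{HArr}(y)$) have disjoint covering sets. $\mathcal C$ is globally idempotent and commutative if it divides some flat idempotent and commutative forest algebra.
   Formalization: In axiom (4) of a forest category the law f(u+c)=(fu)+c is also required for half-arrows f in HArr(x), not only for arrows f in Arr(w,x); without it the equivalence fails. *)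

theory Defs
  imports "HOL-Algebra.Group" "HOL-Library.Disjoint_Sets"
begin

section \<open>Forest algebras\<close>

text \<open>All monoids are monoids of HOL-Algebra, so the additive monoids of the theory of forest
  algebras appear with the multiplicative symbols of that library.\<close>

record ('h, 'v) forest_algebra =
  Hor :: "'h monoid"
  Ver :: "'v monoid"
  fact :: "'h \<Rightarrow> 'v \<Rightarrow> 'h"
  fins :: "'v \<Rightarrow> 'h \<Rightarrow> 'v"

text \<open>\<open>fact g v\<close> is $gv$ and \<open>fins v h\<close> is $v+h$. As the action is faithful, \<open>fins\<close> is determined
  on the carriers by the other three components, so recording it is no extra structure.\<close>

locale is_forest_algebra =
  fixes F :: "('h, 'v) forest_algebra" (structure)
  assumes Hor_comm_monoid: "comm_monoid (Hor F)"
    and Ver_monoid: "monoid (Ver F)"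
    and fact_closed: "\<lbrakk>g \<in> carrier (Hor F); v \<in> carrier (Ver F)\<rbrakk> \<Longrightarrow> fact F g v \<in> carrier (Hor F)"
    and fact_one: "g \<in> carrier (Hor F) \<Longrightarrow> fact F g \<one>\<^bsub>Ver F\<^esub> = g"
    and fact_mult: "\<lbrakk>g \<in> carrier (Hor F); v \<in> carrier (Ver F); w \<in> carrier (Ver F)\<rbrakk>
      \<Longrightarrow> fact F g (v \<otimes>\<^bsub>Ver F\<^esub> w) = fact F (fact F g v) w"
    and fact_faithful: "\<lbrakk>v \<in> carrier (Ver F); w \<in> carrier (Ver F);
        \<And>g. g \<in> carrier (Hor F) \<Longrightarrow> fact F g v = fact F g w\<rbrakk> \<Longrightarrow> v = w"
    and fins_closed: "\<lbrakk>v \<in> carrier (Ver F); h \<in> carrier (Hor F)\<rbrakk> \<Longrightarrow> fins F v h \<in> carrier (Ver F)"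
    and fact_fins: "\<lbrakk>g \<in> carrier (Hor F); v \<in> carrier (Ver F); h \<in> carrier (Hor F)\<rbrakk>
      \<Longrightarrow> fact F g (fins F v h) = fact F g v \<otimes>\<^bsub>Hor F\<^esub> h"

locale idem_comm_monoid = comm_monoid +
  assumes idem: "x \<in> carrier G \<Longrightarrow> x \<otimes> x = x"

definition flat_forest_algebra :: "'h monoid \<Rightarrow> ('h, 'h) forest_algebra" where
  "flat_forest_algebra H =
     \<lparr>Hor = H, Ver = H, fact = (\<lambda>h v. h \<otimes>\<^bsub>H\<^esub> v), fins = (\<lambda>v h. v \<otimes>\<^bsub>H\<^esub> h)\<rparr>"

lemma flat_forest_algebra_simps [simp]:
  "Hor (flat_forest_algebra H) = H"
  "Ver (flat_forest_algebra H) = H"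
  "fact (flat_forest_algebra H) h v = h \<otimes>\<^bsub>H\<^esub> v"
  "fins (flat_forest_algebra H) v h = v \<otimes>\<^bsub>H\<^esub> h"
  by (simp_all add: flat_forest_algebra_def)

lemma is_forest_algebra_flat:
  assumes "idem_comm_monoid H"
  shows "is_forest_algebra (flat_forest_algebra H)"
proof -
  interpret idem_comm_monoid H by fact
  show ?thesis
  proof
    fix v w
    assume "v \<in> carrier (Ver (flat_forest_algebra H))" "w \<in> carrier (Ver (flat_forest_algebra H))"
      and eq: "\<And>g. g \<in> carrier (Hor (flat_forest_algebra H)) \<Longrightarrow>
             fact (flat_forest_algebra H) g v = fact (flat_forest_algebra H) g w"
    then have "\<one>\<^bsub>H\<^esub> \<otimes>\<^bsub>H\<^esub> v = \<one>\<^bsub>H\<^esub> \<otimes>\<^bsub>H\<^esub> w" "v \<in> carrier H" "w \<in> carrier H"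
      using eq[of "\<one>\<^bsub>H\<^esub>"] by (simp_all del: l_one r_one)
    then show "v = w" by simp
  qed (simp_all add: m_ac)
qed


section \<open>Forest categories\<close>

record ('o, 'h, 'a) forest_category =
  Obj :: "'o monoid"
  HArr :: "'o \<Rightarrow> 'h set"
  Half :: "'h monoid"
  Arr :: "'o \<Rightarrow> 'o \<Rightarrow> 'a set"
  Ident :: "'o \<Rightarrow> 'a"
  comp :: "'a \<Rightarrow> 'a \<Rightarrow> 'a" (infixl \<open>\<bullet>\<index>\<close> 70)
  act :: "'h \<Rightarrow> 'a \<Rightarrow> 'h" (infixl \<open>\<cdot>\<index>\<close> 70)
  plusA :: "'a \<Rightarrow> 'h \<Rightarrow> 'a" (infixl \<open>\<oplus>\<^sub>A\<index>\<close> 65)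

abbreviation plusO :: "('o, 'h, 'a, 'm) forest_category_scheme \<Rightarrow> 'o \<Rightarrow> 'o \<Rightarrow> 'o"
    (infixl \<open>\<oplus>\<^sub>O\<index>\<close> 65)
  where "x \<oplus>\<^sub>O\<^bsub>C\<^esub> y \<equiv> x \<otimes>\<^bsub>Obj C\<^esub> y"

abbreviation plusH :: "('o, 'h, 'a, 'm) forest_category_scheme \<Rightarrow> 'h \<Rightarrow> 'h \<Rightarrow> 'h"
    (infixl \<open>\<oplus>\<^sub>H\<index>\<close> 65)
  where "c \<oplus>\<^sub>H\<^bsub>C\<^esub> d \<equiv> c \<otimes>\<^bsub>Half C\<^esub> d"

abbreviation Objs :: "('o, 'h, 'a, 'm) forest_category_scheme \<Rightarrow> 'o set"
  where "Objs C \<equiv> carrier (Obj C)"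

definition Arrs :: "('o, 'h, 'a, 'm) forest_category_scheme \<Rightarrow> 'a set"
  where "Arrs C = (\<Union>x\<in>Objs C. \<Union>y\<in>Objs C. Arr C x y)"

text \<open>The end map sends the elements of \<open>HArr C x\<close> to \<open>x\<close>; \<open>HArr_plus\<close> and \<open>HArr_zero\<close>
  say that it is a monoid homomorphism, \<open>HArr_nonempty\<close> that it is onto.

  The rule $f(u+c) = (fu)+c$ is required both for arrows $f$ (\<open>comp_plusA\<close>) and for
  half-arrows $f$ (\<open>act_plusA\<close>). The second is
  the counterpart of \<open>fact_fins\<close>; it does not follow from the first, and without it division
  into a forest algebra would impose a further identity on the category.\<close>

locale is_forest_category =
  fixes C :: "('o, 'h, 'a) forest_category" (structure)
  assumes Obj_comm_monoid: "comm_monoid (Obj C)"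
    and finite_Obj: "finite (Objs C)"
    and Arr_disjoint: "disjoint_family_on (\<lambda>(x, y). Arr C x y) (Objs C \<times> Objs C)"
    and HArr_disjoint: "disjoint_family_on (HArr C) (Objs C)"
    and Half_comm_monoid: "comm_monoid (Half C)"
    and Half_carrier: "carrier (Half C) = (\<Union>x\<in>Objs C. HArr C x)"
    and HArr_plus: "\<lbrakk>x \<in> Objs C; y \<in> Objs C; c \<in> HArr C x; d \<in> HArr C y\<rbrakk>
      \<Longrightarrow> c \<oplus>\<^sub>H d \<in> HArr C (x \<oplus>\<^sub>O y)"
    and HArr_zero: "\<one>\<^bsub>Half C\<^esub> \<in> HArr C \<one>\<^bsub>Obj C\<^esub>"
    and HArr_nonempty: "x \<in> Objs C \<Longrightarrow> HArr C x \<noteq> {}"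
    and comp_closed: "\<lbrakk>x \<in> Objs C; y \<in> Objs C; z \<in> Objs C; u \<in> Arr C x y; v \<in> Arr C y z\<rbrakk>
      \<Longrightarrow> u \<bullet> v \<in> Arr C x z"
    and comp_assoc: "\<lbrakk>w \<in> Objs C; x \<in> Objs C; y \<in> Objs C; z \<in> Objs C;
        t \<in> Arr C w x; u \<in> Arr C x y; v \<in> Arr C y z\<rbrakk> \<Longrightarrow> (t \<bullet> u) \<bullet> v = t \<bullet> (u \<bullet> v)"
    and Ident_closed: "x \<in> Objs C \<Longrightarrow> Ident C x \<in> Arr C x x"
    and Ident_comp: "\<lbrakk>x \<in> Objs C; y \<in> Objs C; u \<in> Arr C x y\<rbrakk> \<Longrightarrow> Ident C x \<bullet> u = u"
    and comp_Ident: "\<lbrakk>x \<in> Objs C; y \<in> Objs C; u \<in> Arr C x y\<rbrakk> \<Longrightarrow> u \<bullet> Ident C y = u"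
    and act_closed: "\<lbrakk>x \<in> Objs C; y \<in> Objs C; c \<in> HArr C x; u \<in> Arr C x y\<rbrakk>
      \<Longrightarrow> c \<cdot> u \<in> HArr C y"
    and act_comp: "\<lbrakk>x \<in> Objs C; y \<in> Objs C; z \<in> Objs C; c \<in> HArr C x; u \<in> Arr C x y;
        v \<in> Arr C y z\<rbrakk> \<Longrightarrow> (c \<cdot> u) \<cdot> v = c \<cdot> (u \<bullet> v)"
    and act_Ident: "\<lbrakk>x \<in> Objs C; c \<in> HArr C x\<rbrakk> \<Longrightarrow> c \<cdot> Ident C x = c"
    and act_faithful: "\<lbrakk>x \<in> Objs C; y \<in> Objs C; u \<in> Arr C x y; u' \<in> Arr C x y;
        \<And>c. c \<in> HArr C x \<Longrightarrow> c \<cdot> u = c \<cdot> u'\<rbrakk> \<Longrightarrow> u = u'"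
    and plusA_closed: "\<lbrakk>x \<in> Objs C; y \<in> Objs C; z \<in> Objs C; u \<in> Arr C x y; c \<in> HArr C z\<rbrakk>
      \<Longrightarrow> u \<oplus>\<^sub>A c \<in> Arr C x (y \<oplus>\<^sub>O z)"
    and comp_plusA: "\<lbrakk>w \<in> Objs C; x \<in> Objs C; y \<in> Objs C; z \<in> Objs C; f \<in> Arr C w x;
        u \<in> Arr C x y; c \<in> HArr C z\<rbrakk> \<Longrightarrow> f \<bullet> (u \<oplus>\<^sub>A c) = (f \<bullet> u) \<oplus>\<^sub>A c"
    and act_plusA: "\<lbrakk>x \<in> Objs C; y \<in> Objs C; z \<in> Objs C; c \<in> HArr C x;
        u \<in> Arr C x y; d \<in> HArr C z\<rbrakk> \<Longrightarrow> c \<cdot> (u \<oplus>\<^sub>A d) = (c \<cdot> u) \<oplus>\<^sub>H d"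
    and plusA_plusH: "\<lbrakk>x \<in> Objs C; y \<in> Objs C; z \<in> Objs C; z' \<in> Objs C; u \<in> Arr C x y;
        c \<in> HArr C z; d \<in> HArr C z'\<rbrakk> \<Longrightarrow> (u \<oplus>\<^sub>A c) \<oplus>\<^sub>A d = u \<oplus>\<^sub>A (c \<oplus>\<^sub>H d)"

locale finite_forest_category = is_forest_category +
  assumes finite_Half: "finite (carrier (Half C))"
    and finite_Arrs: "finite (Arrs C)"


section \<open>Division\<close>

text \<open>\<open>K\<close> and \<open>L\<close> assign the covering sets of the half-arrows and of the arrows, respectively.\<close>

definition covering ::
  "('o, 'h, 'a) forest_category \<Rightarrow> ('m, 'v) forest_algebra \<Rightarrow> ('h \<Rightarrow> 'm set) \<Rightarrow> ('a \<Rightarrow> 'v set) \<Rightarrow> bool"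
  where "covering C F K L \<longleftrightarrow>
    (\<forall>c\<in>carrier (Half C). K c \<noteq> {} \<and> K c \<subseteq> carrier (Hor F)) \<and>
    (\<forall>u\<in>Arrs C. L u \<noteq> {} \<and> L u \<subseteq> carrier (Ver F)) \<and>
    (\<forall>x\<in>Objs C. \<forall>y\<in>Objs C. \<forall>z\<in>Objs C. \<forall>u\<in>Arr C x y. \<forall>v\<in>Arr C y z.
       \<forall>k\<in>L u. \<forall>l\<in>L v. k \<otimes>\<^bsub>Ver F\<^esub> l \<in> L (u \<bullet>\<^bsub>C\<^esub> v)) \<and>
    (\<forall>x\<in>Objs C. \<forall>y\<in>Objs C. \<forall>c\<in>HArr C x. \<forall>u\<in>Arr C x y.
       \<forall>k\<in>K c. \<forall>l\<in>L u. fact F k l \<in> K (c \<cdot>\<^bsub>C\<^esub> u)) \<and>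
    (\<forall>c\<in>carrier (Half C). \<forall>d\<in>carrier (Half C).
       \<forall>k\<in>K c. \<forall>l\<in>K d. k \<otimes>\<^bsub>Hor F\<^esub> l \<in> K (c \<oplus>\<^sub>H\<^bsub>C\<^esub> d)) \<and>
    (\<forall>u\<in>Arrs C. \<forall>c\<in>carrier (Half C).
       \<forall>k\<in>L u. \<forall>l\<in>K c. fins F k l \<in> L (u \<oplus>\<^sub>A\<^bsub>C\<^esub> c)) \<and>
    (\<forall>x\<in>Objs C. \<forall>y\<in>Objs C. disjoint_family_on L (Arr C x y)) \<and>
    (\<forall>y\<in>Objs C. disjoint_family_on K (HArr C y))"

definition divides ::
  "('o, 'h, 'a) forest_category \<Rightarrow> ('m, 'v) forest_algebra \<Rightarrow> bool" (infix \<open>\<prec>\<close> 50)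
  where "C \<prec> F \<longleftrightarrow> (\<exists>K L. covering C F K L)"

text \<open>HOL cannot quantify over the carrier type of the flat forest algebra, so it is fixed to be
  \<open>nat\<close>. For finite forest categories this is no restriction: by
  \<open>globally_idem_comm_if_divides_flat\<close> below, a category that divides a flat idempotent and
  commutative forest algebra over any type divides one over \<open>nat\<close>.\<close>

definition globally_idem_comm :: "('o, 'h, 'a) forest_category \<Rightarrow> bool"
  where "globally_idem_comm C \<longleftrightarrow>
    (\<exists>H :: nat monoid. idem_comm_monoid H \<and> C \<prec> flat_forest_algebra H)"

definition or_monoid :: "nat monoid"
  where "or_monoid = \<lparr>carrier = UNIV, mult = (or), one = 0\<rparr>"

lemma idem_comm_or_monoid: "idem_comm_monoid or_monoid"
  by unfold_locales (simp_all add: or_monoid_def ac_simps)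

primrec bit_prod :: "('m, 'k) monoid_scheme \<Rightarrow> (nat \<Rightarrow> 'm) \<Rightarrow> nat \<Rightarrow> nat \<Rightarrow> 'm" where
  "bit_prod H e 0 m = \<one>\<^bsub>H\<^esub>"
| "bit_prod H e (Suc n) m = (if bit m n then e n else \<one>\<^bsub>H\<^esub>) \<otimes>\<^bsub>H\<^esub> bit_prod H e n m"

context idem_comm_monoid
begin

lemma bit_prod_closed:
  "(\<And>i. i < n \<Longrightarrow> e i \<in> carrier G) \<Longrightarrow> bit_prod G e n m \<in> carrier G"
  by (induction n) auto

lemma bit_prod_or:
  "(\<And>i. i < n \<Longrightarrow> e i \<in> carrier G) \<Longrightarrow>
   bit_prod G e n (or k m) = bit_prod G e n k \<otimes> bit_prod G e n m"
proof (induction n)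
  case (Suc n)
  have e: "e n \<in> carrier G" and c: "bit_prod G e n k \<in> carrier G" "bit_prod G e n m \<in> carrier G"
    using Suc.prems by (auto intro: bit_prod_closed)
  have "e n \<otimes> (bit_prod G e n k \<otimes> bit_prod G e n m) =
        (e n \<otimes> e n) \<otimes> (bit_prod G e n k \<otimes> bit_prod G e n m)"
    using e by (simp add: idem)
  also have "\<dots> = (e n \<otimes> bit_prod G e n k) \<otimes> (e n \<otimes> bit_prod G e n m)"
    using e c by (simp add: m_ac)
  finally show ?case using Suc e c by (auto simp: bit_or_iff m_ac)
qed auto

lemma bit_prod_singleton:
  "(\<And>i. i < n \<Longrightarrow> e i \<in> carrier G) \<Longrightarrow>
   bit_prod G e n (2 ^ j) = (if j < n then e j else \<one>)"
  by (induction n) (auto simp: bit_simps less_Suc_eq)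

end

lemma globally_idem_comm_if_divides_flat:
  fixes H :: "'m monoid"
  assumes "finite_forest_category C" and "idem_comm_monoid H" and "C \<prec> flat_forest_algebra H"
  shows "globally_idem_comm C"
proof -
  interpret finite_forest_category C by fact
  interpret H: idem_comm_monoid H by fact
  obtain K L where cov: "covering C (flat_forest_algebra H) K L"
    using assms(3) by (auto simp: divides_def)
  define a where "a = (\<lambda>c. SOME k. k \<in> K c)"
  define b where "b = (\<lambda>u. SOME l. l \<in> L u)"
  have a: "a c \<in> K c" "a c \<in> carrier H" if "c \<in> carrier (Half C)" for c
  proof -
    have "K c \<noteq> {}" "K c \<subseteq> carrier H"
      using cov that by (auto simp: covering_def)
    then show "a c \<in> K c" "a c \<in> carrier H"
      using some_in_eq[of "K c"] unfolding a_def by blast+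
  qed
  have b: "b u \<in> L u" "b u \<in> carrier H" if "u \<in> Arrs C" for u
  proof -
    have "L u \<noteq> {}" "L u \<subseteq> carrier H"
      using cov that by (auto simp: covering_def)
    then show "b u \<in> L u" "b u \<in> carrier H"
      using some_in_eq[of "L u"] unfolding b_def by blast+
  qed
  define X where "X = a ` carrier (Half C) \<union> b ` Arrs C"
  have X: "X \<subseteq> carrier H"
    unfolding X_def using a(2) b(2) by auto
  have "finite X"
    unfolding X_def using finite_Half finite_Arrs by simp
  then obtain n :: nat and e where e: "X = e ` {i. i < n}"
    using finite_imp_nat_seg_image_inj_on by metis
  have eH: "e i \<in> carrier H" if "i < n" for i
    using that X unfolding e by auto
  define p where "p = bit_prod H e n"
  have p_or: "p (or k m) = p k \<otimes>\<^bsub>H\<^esub> p m" for k m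
    unfolding p_def using eH by (rule H.bit_prod_or)
  have p_surj: "\<exists>m. p m = h" if h: "h \<in> X" for h
  proof -
    obtain i where "i < n" "h = e i"
      using h unfolding e by auto
    then have "p (2 ^ i) = h"
      unfolding p_def by (subst H.bit_prod_singleton) (simp_all add: eH)
    then show ?thesis ..
  qed
  have K_nonempty: "p -` K c \<noteq> {}" if "c \<in> carrier (Half C)" for c
    using p_surj[of "a c"] a(1)[OF that] that by (auto simp: X_def)
  have L_nonempty: "p -` L u \<noteq> {}" if "u \<in> Arrs C" for u
    using p_surj[of "b u"] b(1)[OF that] that by (auto simp: X_def)
  have "covering C (flat_forest_algebra or_monoid) (\<lambda>c. p -` K c) (\<lambda>u. p -` L u)"
    using cov K_nonempty L_nonempty
    by (simp add: covering_def or_monoid_def p_or disjoint_family_on_def flip: vimage_Int)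
  then show ?thesis
    using idem_comm_or_monoid unfolding globally_idem_comm_def divides_def by blast
qed

end

theory Submission
  imports Defs
begin

text \<open>
  For necessity, choose covering elements: in a flat idempotent and commutative algebra both sides
  of each identity are covered by the same element, and they have the same end.

  For sufficiency, build half-arrows from the labels in \<open>HArr\<close> and \<open>Arr\<close> by sums and actions, and
  record the set of labels used. It suffices that this content and the end determine the value:
  then \<open>C\<close> divides the algebra of sets of labels under union, faithfulness taking care of the
  arrows. Let \<open>g\<close> be built with content \<open>S\<close>. Each label in \<open>S\<close> is the outermost label of a subterm
  of \<open>g\<close>, and horizontal absorption lets a subterm of \<open>g\<close> be absorbed anywhere in the presence
  of \<open>g\<close>. By induction, so is every half-arrow \<open>f\<close> whose content is contained in \<open>S\<close>: if
  \<open>f = f'u\<close>, then \<open>g\<close> has a subterm \<open>cu\<close>, and \<open>f'\<close> can be replaced by \<open>c\<close> since each of the two is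
  absorbed by the other. Two half-arrows with the same content and end thus absorb each
  other.
\<close>

section \<open>Half-arrows built from labels, and their subterms\<close>

context is_forest_category
begin

sublocale Ob: comm_monoid "Obj C" by (rule Obj_comm_monoid)
sublocale Hf: comm_monoid "Half C" by (rule Half_comm_monoid)

lemma HArr_carrier: "x \<in> Objs C \<Longrightarrow> c \<in> HArr C x \<Longrightarrow> c \<in> carrier (Half C)"
  using Half_carrier by blast

lemma HArr_unique:
  "\<lbrakk>x \<in> Objs C; y \<in> Objs C; c \<in> HArr C x; c \<in> HArr C y\<rbrakk> \<Longrightarrow> x = y"
  using HArr_disjoint by (auto simp: disjoint_family_on_def)

lemma Arr_unique:
  assumes "x \<in> Objs C" "y \<in> Objs C" "x' \<in> Objs C" "y' \<in> Objs C" "u \<in> Arr C x y" "u \<in> Arr C x' y'"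
  shows "x = x' \<and> y = y'"
proof (rule ccontr)
  assume "\<not> ?thesis"
  then have "Arr C x y \<inter> Arr C x' y' = {}"
    using disjoint_family_onD[OF Arr_disjoint, of "(x, y)" "(x', y')"] assms by auto
  then show False using assms by blast
qed

text \<open>The set is the content of a term, recording neither order nor multiplicity of labels.
  The end is a separate argument because the content does not determine it:
  \<open>c \<cdot> u\<close> and \<open>c \<oplus>\<^sub>H c \<cdot> u\<close> have the same
  content.\<close>

inductive generated :: "('h + 'a) set \<Rightarrow> 'o \<Rightarrow> 'h \<Rightarrow> bool" where
  half: "\<lbrakk>x \<in> Objs C; c \<in> HArr C x\<rbrakk> \<Longrightarrow> generated {Inl c} x c"
| plus: "\<lbrakk>generated S x c; generated T y d\<rbrakk> \<Longrightarrow> generated (S \<union> T) (x \<oplus>\<^sub>O y) (c \<oplus>\<^sub>H d)"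
| act: "\<lbrakk>generated S x c; y \<in> Objs C; u \<in> Arr C x y\<rbrakk> \<Longrightarrow> generated (insert (Inr u) S) y (c \<cdot> u)"

lemma generated_closed: "generated S x c \<Longrightarrow> x \<in> Objs C \<and> c \<in> HArr C x"
  by (induction rule: generated.induct) (auto intro: HArr_plus act_closed)

text \<open>The path from the leaf \<open>c\<close> to the root composes to a single arrow: sums met
  on the way enter through \<open>\<oplus>\<^sub>A\<close>, actions through
  \<open>\<bullet>\<close>.\<close>

lemma generated_half_occurs:
  assumes "generated S z g" "Inl c \<in> S" "x \<in> Objs C" "c \<in> HArr C x"
  shows "\<exists>t\<in>Arr C x z. g = c \<cdot> t"
  using assms
proof (induction rule: generated.induct)
  case (half z d)
  then have "z = x" using HArr_unique by auto
  then show ?case using half by (auto intro!: bexI[of _ "Ident C x"] simp: act_Ident Ident_closed)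
next
  case (plus S y d T y' d')
  have cl: "y \<in> Objs C" "d \<in> HArr C y" "y' \<in> Objs C" "d' \<in> HArr C y'"
    using plus.hyps generated_closed by auto
  show ?case
  proof (cases "Inl c \<in> S")
    case True
    then obtain t where "t \<in> Arr C x y" "d = c \<cdot> t" using plus by auto
    then show ?thesis using cl plus.prems
      by (intro bexI[of _ "t \<oplus>\<^sub>A d'"]) (auto simp: act_plusA intro: plusA_closed)
  next
    case False
    then obtain t where "t \<in> Arr C x y'" "d' = c \<cdot> t" using plus by auto
    then show ?thesis using cl plus.prems
      \<comment> \<open>\<open>\<oplus>\<^sub>A\<close> adds on the right only, so the summand
        containing \<open>c\<close> is moved to the left, in the end as well.\<close>
      by (subst Ob.m_comm, simp, simp, intro bexI[of _ "t \<oplus>\<^sub>A d"])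
        (auto simp: act_plusA Hf.m_comm HArr_carrier intro: plusA_closed)
  qed
next
  case (act S y d y' u)
  then obtain t where "t \<in> Arr C x y" "d = c \<cdot> t" by auto
  then show ?case using act.hyps act.prems generated_closed[OF act.hyps(1)]
    by (intro bexI[of _ "t \<bullet> u"]) (auto simp: act_comp intro: comp_closed)
qed

lemma generated_arrow_occurs:
  assumes "generated S z g" "Inr u \<in> S" "x \<in> Objs C" "y \<in> Objs C" "u \<in> Arr C x y"
  shows "\<exists>c\<in>HArr C x. \<exists>t\<in>Arr C y z. g = c \<cdot> u \<cdot> t"
  using assms
proof (induction rule: generated.induct)
  case (half z d)
  then show ?case by simp
next
  case (plus S w d T w' d')
  have cl: "w \<in> Objs C" "d \<in> HArr C w" "w' \<in> Objs C" "d' \<in> HArr C w'"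
    using plus.hyps generated_closed by auto
  show ?case
  proof (cases "Inr u \<in> S")
    case True
    then obtain c t where "c \<in> HArr C x" "t \<in> Arr C y w" "d = c \<cdot> u \<cdot> t" using plus by auto
    then show ?thesis using cl plus.prems act_closed
      by (intro bexI[of _ c] bexI[of _ "t \<oplus>\<^sub>A d'"]) (auto simp: act_plusA intro: plusA_closed)
  next
    case False
    then obtain c t where "c \<in> HArr C x" "t \<in> Arr C y w'" "d' = c \<cdot> u \<cdot> t" using plus by auto
    moreover from this have "c \<cdot> u \<in> HArr C y" using act_closed plus.prems by blast
    ultimately show ?thesis using cl plus.prems
      by (subst Ob.m_comm, simp, simp, intro bexI[of _ c] bexI[of _ "t \<oplus>\<^sub>A d"])
        (auto simp: act_plusA Hf.m_comm HArr_carrier intro: plusA_closed)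
  qed
next
  case (act S w d w' v)
  have cl: "w \<in> Objs C" "d \<in> HArr C w" using act.hyps generated_closed by auto
  show ?case
  proof (cases "Inr u \<in> S")
    case True
    then obtain c t where c: "c \<in> HArr C x" "t \<in> Arr C y w" "d = c \<cdot> u \<cdot> t" using act by auto
    moreover from this have "c \<cdot> u \<in> HArr C y" using act_closed act.prems by blast
    ultimately show ?thesis
      using cl act.hyps act.prems act_comp[of y w w' "c \<cdot> u" t v] comp_closed[of y w w' t v]
      by (intro bexI[of _ c] bexI[of _ "t \<bullet> v"]) auto
  next
    case False
    \<comment> \<open>Here \<open>u\<close> is the outermost label, so the subterm is the whole of
      \<open>d \<cdot> u\<close> and the remaining path is the identity.\<close>
    then have "v = u" using act.prems by simp
    then have "w = x" "w' = y" using Arr_unique act cl by blast+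
    moreover have "d \<cdot> u \<in> HArr C y" using act cl \<open>v = u\<close> calculation act_closed by blast
    ultimately show ?thesis using cl act \<open>v = u\<close>
      by (intro bexI[of _ d] bexI[of _ "Ident C y"]) (auto simp: act_Ident Ident_closed)
  qed
qed

end

section \<open>Absorption of half-arrows by content\<close>

locale absorbing_forest_category = is_forest_category C + Ob: idem_comm_monoid "Obj C"
  for C :: "('o, 'h, 'a) forest_category" (structure) +
  assumes absorption: "\<lbrakk>x \<in> Objs C; y \<in> Objs C; z \<in> Objs C; z' \<in> Objs C;
      r \<in> HArr C x; s \<in> HArr C (x \<oplus>\<^sub>O y); t \<in> Arr C (x \<oplus>\<^sub>O y) z; u \<in> Arr C x z'\<rbrakk>
      \<Longrightarrow> (r \<oplus>\<^sub>H s) \<cdot> t \<oplus>\<^sub>H r \<cdot> u = s \<cdot> t \<oplus>\<^sub>H r \<cdot> u"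
    and Half_idem: "r \<in> carrier (Half C) \<Longrightarrow> r \<oplus>\<^sub>H r = r"
begin

text \<open>Horizontal absorption in terms of the semilattice order on objects:
  \<open>x \<oplus>\<^sub>O y = y\<close> says that \<open>x\<close> lies below
  \<open>y\<close>.\<close>

lemma absorb_subterm:
  assumes "x \<in> Objs C" "y \<in> Objs C" "z \<in> Objs C" "z' \<in> Objs C" "x \<oplus>\<^sub>O y = y"
    and "r \<in> HArr C x" "s \<in> HArr C y" "t \<in> Arr C y z" "u \<in> Arr C x z'"
  shows "(r \<oplus>\<^sub>H s) \<cdot> t \<oplus>\<^sub>H r \<cdot> u = s \<cdot> t \<oplus>\<^sub>H r \<cdot> u"
  using absorption[of x y z z' r s t u] assms by simp

text \<open>The context, adding \<open>s\<close> and then acting by \<open>t\<close>, is arbitrary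
  so that the induction can enlarge it: for a sum the other summand joins \<open>s\<close>, for an
  action the arrow joins \<open>t\<close>. The condition on \<open>x\<close> and \<open>y\<close>
  keeps the end of \<open>f \<oplus>\<^sub>H s\<close> at \<open>y\<close>.\<close>

lemma absorb_generated:
  assumes "generated T x f" "generated S w g" "T \<subseteq> S"
    and "y \<in> Objs C" "z \<in> Objs C" "x \<oplus>\<^sub>O y = y" "s \<in> HArr C y" "t \<in> Arr C y z"
  shows "(f \<oplus>\<^sub>H s) \<cdot> t \<oplus>\<^sub>H g = s \<cdot> t \<oplus>\<^sub>H g"
  using assms
proof (induction arbitrary: y s t z rule: generated.induct)
  case (half x c)
  then obtain u where "u \<in> Arr C x w" "g = c \<cdot> u" using generated_half_occurs[of S w g c x] by auto
  then show ?case
    using half absorb_subterm[of x y z w c s t u] generated_closed[OF half.prems(1)] by simp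
next
  case (plus T1 x1 f1 T2 x2 f2)
  have cl: "x1 \<in> Objs C" "f1 \<in> HArr C x1" "x2 \<in> Objs C" "f2 \<in> HArr C x2"
    using plus.hyps generated_closed by auto
  \<comment> \<open>Both \<open>x1\<close> and \<open>x2\<close> lie below
    \<open>x1 \<oplus>\<^sub>O x2\<close>, which lies below \<open>y\<close>.\<close>
  have y1: "x1 \<oplus>\<^sub>O y = y"
    by (metis Ob.idem Ob.m_assoc Ob.m_closed cl(1,3) plus.prems(3,5))
  have y2: "x2 \<oplus>\<^sub>O y = y"
    by (metis Ob.idem Ob.m_assoc Ob.m_comm Ob.m_closed cl(1,3) plus.prems(3,5))
  have f2s: "f2 \<oplus>\<^sub>H s \<in> HArr C y" using HArr_plus[of x2 y f2 s] cl y2 plus.prems by simp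
  have "(f1 \<oplus>\<^sub>H f2 \<oplus>\<^sub>H s) \<cdot> t \<oplus>\<^sub>H g = (f1 \<oplus>\<^sub>H (f2 \<oplus>\<^sub>H s)) \<cdot> t \<oplus>\<^sub>H g"
    using cl plus.prems HArr_carrier by (simp add: Hf.m_assoc)
  also have "\<dots> = (f2 \<oplus>\<^sub>H s) \<cdot> t \<oplus>\<^sub>H g" using plus y1 f2s by auto
  also have "\<dots> = s \<cdot> t \<oplus>\<^sub>H g" using plus y2 by auto
  finally show ?case .
next
  case (act T x f x' u)
  have cl: "x \<in> Objs C" "f \<in> HArr C x" "w \<in> Objs C" "x' \<in> Objs C" "u \<in> Arr C x x'"
    using act.hyps act.prems generated_closed by auto
  obtain c v where c: "c \<in> HArr C x" "v \<in> Arr C x' w" "g = c \<cdot> u \<cdot> v"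
    using generated_arrow_occurs[of S w g u x x'] act cl by auto
  have g: "g = c \<cdot> (u \<bullet> v)" "u \<bullet> v \<in> Arr C x w"
    using c cl comp_closed act_comp by auto
  \<comment> \<open>The context of \<open>d \<cdot> u\<close> becomes one arrow applied to
    \<open>d\<close>, which makes the induction hypothesis applicable to \<open>f\<close>.\<close>
  define p where "p = (u \<oplus>\<^sub>A s) \<bullet> t"
  have us: "u \<oplus>\<^sub>A s \<in> Arr C x y" using plusA_closed[of x x' y u s] cl act.prems by simp
  then have p: "p \<in> Arr C x z" using comp_closed cl act.prems by (auto simp: p_def)
  have p_act: "(d \<cdot> u \<oplus>\<^sub>H s) \<cdot> t = d \<cdot> p" if "d \<in> HArr C x" for d
    using act_plusA[of x x' y d u s] act_comp[of x y z d "u \<oplus>\<^sub>A s" t] us cl act.prems that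
    by (simp add: p_def)
  \<comment> \<open>Absorption by \<open>g\<close> is used backwards to insert its subterm
    \<open>c\<close> next to \<open>f\<close>; the induction hypothesis then removes
    \<open>f\<close>, leaving \<open>c\<close> in its place.\<close>
  have "f \<cdot> p \<oplus>\<^sub>H g = (c \<oplus>\<^sub>H f) \<cdot> p \<oplus>\<^sub>H g"
    using absorb_subterm[of x x z w c f p "u \<bullet> v"] cl c p g act.prems Ob.idem by simp
  also have "c \<oplus>\<^sub>H f = f \<oplus>\<^sub>H c" using cl c HArr_carrier Hf.m_comm by blast
  also have "(f \<oplus>\<^sub>H c) \<cdot> p \<oplus>\<^sub>H g = c \<cdot> p \<oplus>\<^sub>H g"
    using act.IH[of x z c p] act.prems cl c p Ob.idem by simp
  finally have "(f \<cdot> u \<oplus>\<^sub>H s) \<cdot> t \<oplus>\<^sub>H g = (c \<cdot> u \<oplus>\<^sub>H s) \<cdot> t \<oplus>\<^sub>H g"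
    using p_act cl c by simp
  \<comment> \<open>Now \<open>c \<cdot> u\<close> is itself a subterm of \<open>g\<close>.\<close>
  also have "\<dots> = s \<cdot> t \<oplus>\<^sub>H g"
    using absorb_subterm[of x' y z w "c \<cdot> u" s t v] act_closed[of x x' c u] cl c act.prems by simp
  finally show ?case .
qed

lemma generated_determines:
  assumes "generated S x f" "generated S x g"
  shows "f = g"
proof -
  have le: "c \<oplus>\<^sub>H d = d" if "generated S x c" "generated S x d" for c d
  proof -
    have cl: "x \<in> Objs C" "c \<in> HArr C x" "d \<in> HArr C x" "c \<oplus>\<^sub>H d \<in> HArr C x"
      using that generated_closed HArr_plus[of x x c d] Ob.idem by auto
    \<comment> \<open>In the identity context with \<open>s\<close> and \<open>g\<close> both equal
      to \<open>d\<close>, idempotence turns absorption into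
      \<open>c \<oplus>\<^sub>H d = d\<close>.\<close>
    have "(c \<oplus>\<^sub>H d) \<cdot> Ident C x \<oplus>\<^sub>H d = d \<cdot> Ident C x \<oplus>\<^sub>H d"
      using absorb_generated[OF that subset_refl, of x x d "Ident C x"] cl Ident_closed Ob.idem
      by simp
    then show ?thesis using cl by (simp add: act_Ident Hf.m_assoc Half_idem HArr_carrier)
  qed
  have "f \<in> carrier (Half C)" "g \<in> carrier (Half C)"
    using assms generated_closed HArr_carrier by blast+
  then show ?thesis using le[OF assms] le[OF assms(2,1)] Hf.m_comm by metis
qed

section \<open>Division of the algebra of label sets\<close>

lemma divides_flat_sets:
  "C \<prec> flat_forest_algebra \<lparr>carrier = UNIV, mult = (\<union>), one = {} :: ('h + 'a) set\<rparr>"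
proof -
  define K where "K c = {S. \<exists>x. generated S x c}" for c
  \<comment> \<open>Arrows are not generated, so a set covers \<open>u\<close> if adding it to the
    content of any \<open>c\<close> gives a content of \<open>c \<cdot> u\<close>. This makes the
    covering sets closed under composition and \<open>\<oplus>\<^sub>A\<close>. The ends of
    \<open>u\<close> are quantified since \<open>L\<close> receives only the label; they are unique
    by \<open>Arr_unique\<close>.\<close>
  define L where "L u = {S. \<forall>x\<in>Objs C. \<forall>y\<in>Objs C. u \<in> Arr C x y \<longrightarrow>
    (\<forall>T c. generated T x c \<longrightarrow> generated (T \<union> S) y (c \<cdot> u))}" for u
  have LI: "S \<in> L u" if "x \<in> Objs C" "y \<in> Objs C" "u \<in> Arr C x y"
    "\<And>T c. generated T x c \<Longrightarrow> generated (T \<union> S) y (c \<cdot> u)" for S u x y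
  proof -
    have "x' = x \<and> y' = y" if "x' \<in> Objs C" "y' \<in> Objs C" "u \<in> Arr C x' y'" for x' y'
      using Arr_unique[OF that(1,2) \<open>x \<in> Objs C\<close> \<open>y \<in> Objs C\<close> that(3) \<open>u \<in> Arr C x y\<close>] .
    then show ?thesis using that(4) by (auto simp: L_def)
  qed
  have LD: "generated (T \<union> S) y (c \<cdot> u)" if "S \<in> L u" "x \<in> Objs C" "y \<in> Objs C" "u \<in> Arr C x y"
    "generated T x c" for S T u x y c
    using that unfolding L_def by blast
  have KD: "generated S x c" if "S \<in> K c" "x \<in> Objs C" "c \<in> HArr C x" for S x c
  proof -
    from that(1) obtain y where y: "generated S y c" by (auto simp: K_def)
    then have "y = x" using HArr_unique[of y x c] generated_closed[OF y] that by simp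
    then show ?thesis using y by simp
  qed
  have K_ne: "K c \<noteq> {}" if "c \<in> carrier (Half C)" for c
    using that half unfolding K_def Half_carrier by blast
  have L_ne: "L u \<noteq> {}" if u: "u \<in> Arrs C" for u
  proof -
    obtain x y where xy: "x \<in> Objs C" "y \<in> Objs C" "u \<in> Arr C x y" using u by (auto simp: Arrs_def)
    have "{Inr u} \<in> L u" using xy act by (intro LI[of x y]) auto
    then show ?thesis by blast
  qed
  have L_comp: "S \<union> T \<in> L (u \<bullet> v)"
    if "x \<in> Objs C" "y \<in> Objs C" "z \<in> Objs C" "u \<in> Arr C x y" "v \<in> Arr C y z"
      "S \<in> L u" "T \<in> L v" for x y z u v S T
  proof (rule LI[of x z])
    fix R c assume gen: "generated R x c"
    have "generated ((R \<union> S) \<union> T) z (c \<cdot> u \<cdot> v)"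
      using LD[OF that(7,2,3,5) LD[OF that(6,1,2,4) gen]] .
    then show "generated (R \<union> (S \<union> T)) z (c \<cdot> (u \<bullet> v))"
      using act_comp[of x y z c u v] that generated_closed[OF gen] by (simp add: Un_assoc)
  qed (use that comp_closed in auto)
  have L_plus: "S \<union> T \<in> L (u \<oplus>\<^sub>A d)"
    if u: "u \<in> Arrs C" and d: "d \<in> carrier (Half C)" and S: "S \<in> L u" and T: "T \<in> K d" for u d S T
  proof -
    obtain x y z where o: "x \<in> Objs C" "y \<in> Objs C" "z \<in> Objs C" "u \<in> Arr C x y" "d \<in> HArr C z"
      using u d by (auto simp: Arrs_def Half_carrier)
    show ?thesis
    proof (rule LI[of x "y \<oplus>\<^sub>O z"])
      fix R c assume gen: "generated R x c"
      have "generated ((R \<union> S) \<union> T) (y \<oplus>\<^sub>O z) (c \<cdot> u \<oplus>\<^sub>H d)"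
        using LD[OF S _ _ _ gen] KD[OF T] o by (intro plus) auto
      then show "generated (R \<union> (S \<union> T)) (y \<oplus>\<^sub>O z) (c \<cdot> (u \<oplus>\<^sub>A d))"
        using act_plusA[of x y z c u d] o generated_closed[OF gen] by (simp add: Un_assoc)
    qed (use o plusA_closed in auto)
  qed
  have K_act: "S \<union> T \<in> K (c \<cdot> u)"
    if "x \<in> Objs C" "y \<in> Objs C" "c \<in> HArr C x" "u \<in> Arr C x y" "S \<in> K c" "T \<in> L u" for x y c u S T
  proof -
    have "generated (S \<union> T) y (c \<cdot> u)" using LD[OF that(6,1,2,4) KD[OF that(5,1,3)]] .
    then show ?thesis by (auto simp: K_def)
  qed
  have K_plus: "S \<union> T \<in> K (c \<oplus>\<^sub>H d)" if "S \<in> K c" "T \<in> K d" for c d S T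
    using that plus unfolding K_def by blast
  have K_disj: "disjoint_family_on K (HArr C y)" if y: "y \<in> Objs C" for y
  proof -
    have "c = d" if "c \<in> HArr C y" "d \<in> HArr C y" "S \<in> K c" "S \<in> K d" for c d S
      using generated_determines KD y that by metis
    then show ?thesis unfolding disjoint_family_on_def by blast
  qed
  have L_disj: "disjoint_family_on L (Arr C x y)" if o: "x \<in> Objs C" "y \<in> Objs C" for x y
  proof -
    have "u = v" if uv: "u \<in> Arr C x y" "v \<in> Arr C x y" "S \<in> L u" "S \<in> L v" for u v S
    proof (rule act_faithful[OF o uv(1,2)])
      fix c assume "c \<in> HArr C x"
      \<comment> \<open>Testing on a single label gives \<open>c \<cdot> u\<close> and
        \<open>c \<cdot> v\<close> the common content \<open>{Inl c} \<union> S\<close> and the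
        common end \<open>y\<close>.\<close>
      then have "generated {Inl c} x c" using half o by blast
      then show "c \<cdot> u = c \<cdot> v"
        using LD[OF uv(3) o uv(1)] LD[OF uv(4) o uv(2)] generated_determines by blast
    qed
    then show ?thesis unfolding disjoint_family_on_def by blast
  qed
  have "covering C (flat_forest_algebra \<lparr>carrier = UNIV, mult = (\<union>), one = {}\<rparr>) K L"
    unfolding covering_def flat_forest_algebra_simps partial_object.simps monoid.simps
    by (intro conjI ballI; (rule K_ne L_ne L_comp K_act K_plus L_plus L_disj K_disj subset_UNIV)?;
        assumption?)
  then show ?thesis unfolding divides_def by blast
qed

end

section \<open>Both directions of the equivalence, with the passage from label sets to
  \<open>nat\<close>\<close>

theorem theorem5:
  fixes C :: "('o, 'h, 'a) forest_category" (structure)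
  assumes "finite_forest_category C"
    and "idem_comm_monoid (Obj C)"
  shows "globally_idem_comm C \<longleftrightarrow>
    (\<forall>y\<in>Objs C. \<forall>z\<^sub>1\<in>Objs C. \<forall>z\<^sub>2\<in>Objs C.
       \<forall>r\<in>HArr C y. \<forall>s\<in>Arr C y y. \<forall>t\<^sub>1\<in>Arr C y z\<^sub>1. \<forall>t\<^sub>2\<in>Arr C y z\<^sub>2.
         r \<cdot> s \<cdot> t\<^sub>1 \<oplus>\<^sub>H r \<cdot> s \<cdot> t\<^sub>2 = r \<cdot> t\<^sub>1 \<oplus>\<^sub>H r \<cdot> s \<cdot> t\<^sub>2) \<and>
    (\<forall>x\<in>Objs C. \<forall>y\<in>Objs C. \<forall>z\<in>Objs C. \<forall>z'\<in>Objs C.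
       \<forall>r\<in>HArr C x. \<forall>s\<in>HArr C (x \<oplus>\<^sub>O y). \<forall>t\<in>Arr C (x \<oplus>\<^sub>O y) z. \<forall>u\<in>Arr C x z'.
         (r \<oplus>\<^sub>H s) \<cdot> t \<oplus>\<^sub>H r \<cdot> u = s \<cdot> t \<oplus>\<^sub>H r \<cdot> u) \<and>
    (\<forall>r\<in>carrier (Half C). r = r \<oplus>\<^sub>H r)"
    (is "_ \<longleftrightarrow> ?loop \<and> ?absorb \<and> ?idem")
proof
  interpret finite_forest_category C by fact
  interpret Ob: idem_comm_monoid "Obj C" by fact
  assume "globally_idem_comm C"
  then obtain H :: "nat monoid" and K L where H: "idem_comm_monoid H"
    and cov: "covering C (flat_forest_algebra H) K L"
    unfolding globally_idem_comm_def divides_def by blast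
  interpret H: idem_comm_monoid H by fact
  \<comment> \<open>Sorting with \<open>m_ac\<close> nests products to the right, where a repeated
    factor is removed by this form of idempotence.\<close>
  have idem2: "k \<otimes>\<^bsub>H\<^esub> (k \<otimes>\<^bsub>H\<^esub> l) = k \<otimes>\<^bsub>H\<^esub> l" if "k \<in> carrier H" "l \<in> carrier H" for k l
    using that H.m_assoc[of k k l] H.idem by simp
  have K_ex: "\<exists>k\<in>carrier H. k \<in> K c" if "x \<in> Objs C" "c \<in> HArr C x" for x c
  proof -
    have "K c \<noteq> {}" "K c \<subseteq> carrier H"
      using cov HArr_carrier[OF that] by (auto simp: covering_def)
    then show ?thesis by blast
  qed
  have L_ex: "\<exists>l\<in>carrier H. l \<in> L u" if "x \<in> Objs C" "y \<in> Objs C" "u \<in> Arr C x y" for x y u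
  proof -
    have "u \<in> Arrs C" using that by (auto simp: Arrs_def)
    then have "L u \<noteq> {}" "L u \<subseteq> carrier H"
      using cov by (auto simp: covering_def)
    then show ?thesis by blast
  qed
  have K_act: "k \<otimes>\<^bsub>H\<^esub> l \<in> K (c \<cdot> u)"
    if "x \<in> Objs C" "y \<in> Objs C" "c \<in> HArr C x" "u \<in> Arr C x y" "k \<in> K c" "l \<in> L u" for x y c u k l
    using cov that unfolding covering_def by auto
  have K_plus: "k \<otimes>\<^bsub>H\<^esub> l \<in> K (c \<oplus>\<^sub>H d)"
    if "x \<in> Objs C" "y \<in> Objs C" "c \<in> HArr C x" "d \<in> HArr C y" "k \<in> K c" "l \<in> K d" for x y c d k l
    using cov that HArr_carrier unfolding covering_def by auto
  \<comment> \<open>The equation \<open>k = l\<close> is a premise because the covering elements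
    arise as different products, whose equality is left to rewriting.\<close>
  have K_eq: "c = d" if "y \<in> Objs C" "c \<in> HArr C y" "d \<in> HArr C y" "k \<in> K c" "l \<in> K d" "k = l"
    for y c d k l
    using cov that unfolding covering_def disjoint_family_on_def by blast
  have ?loop
  proof (intro ballI)
    fix y z1 z2 r s t1 t2
    assume o: "y \<in> Objs C" "z1 \<in> Objs C" "z2 \<in> Objs C" "r \<in> HArr C y" "s \<in> Arr C y y"
      "t1 \<in> Arr C y z1" "t2 \<in> Arr C y z2"
    obtain kr ks k1 k2 where k: "kr \<in> K r" "ks \<in> L s" "k1 \<in> L t1" "k2 \<in> L t2"
      and kH: "kr \<in> carrier H" "ks \<in> carrier H" "k1 \<in> carrier H" "k2 \<in> carrier H"
      using K_ex L_ex o by meson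
    note cl = act_closed[OF o(1,1,4,5)]
    note cl1 = act_closed[OF o(1,2) cl o(6)] act_closed[OF o(1,2,4,6)] act_closed[OF o(1,3) cl o(7)]
    note krs = K_act[OF o(1,1,4,5) k(1,2)]
    note m = K_act[OF o(1,2) cl o(6) krs k(3)] K_act[OF o(1,2,4,6) k(1,3)]
      K_act[OF o(1,3) cl o(7) krs k(4)]
    \<comment> \<open>Both sides are covered by the product of \<open>kr\<close>, \<open>ks\<close>,
      \<open>k1\<close> and \<open>k2\<close>.\<close>
    show "r \<cdot> s \<cdot> t1 \<oplus>\<^sub>H r \<cdot> s \<cdot> t2 = r \<cdot> t1 \<oplus>\<^sub>H r \<cdot> s \<cdot> t2"
      by (rule K_eq[OF Ob.m_closed[OF o(2,3)] HArr_plus[OF o(2,3) cl1(1,3)]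
            HArr_plus[OF o(2,3) cl1(2,3)] K_plus[OF o(2,3) cl1(1,3) m(1,3)]
            K_plus[OF o(2,3) cl1(2,3) m(2,3)]])
        (use kH in \<open>simp add: H.m_ac H.idem idem2\<close>)
  qed
  moreover have ?absorb
  proof (intro ballI)
    fix x y z z' r s t u
    assume o: "x \<in> Objs C" "y \<in> Objs C" "z \<in> Objs C" "z' \<in> Objs C" "r \<in> HArr C x"
      "s \<in> HArr C (x \<oplus>\<^sub>O y)" "t \<in> Arr C (x \<oplus>\<^sub>O y) z" "u \<in> Arr C x z'"
    have xy: "x \<oplus>\<^sub>O y \<in> Objs C" "x \<oplus>\<^sub>O (x \<oplus>\<^sub>O y) = x \<oplus>\<^sub>O y"
      using o Ob.m_assoc[of x x y] Ob.idem by auto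
    obtain kr ks kt ku where k: "kr \<in> K r" "ks \<in> K s" "kt \<in> L t" "ku \<in> L u"
      and kH: "kr \<in> carrier H" "ks \<in> carrier H" "kt \<in> carrier H" "ku \<in> carrier H"
      using K_ex[OF o(1,5)] K_ex[OF xy(1) o(6)] L_ex[OF xy(1) o(3,7)] L_ex[OF o(1,4,8)] by meson
    have rs: "r \<oplus>\<^sub>H s \<in> HArr C (x \<oplus>\<^sub>O y)" using HArr_plus[OF o(1) xy(1) o(5,6)] xy by simp
    note krs = K_plus[OF o(1) xy(1) o(5,6) k(1,2)]
    note cl = act_closed[OF xy(1) o(3) rs o(7)] act_closed[OF xy(1) o(3,6,7)]
      act_closed[OF o(1,4,5,8)]
    note m = K_act[OF xy(1) o(3) rs o(7) krs k(3)] K_act[OF xy(1) o(3,6,7) k(2,3)]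
      K_act[OF o(1,4,5,8) k(1,4)]
    \<comment> \<open>The common element is the product of \<open>kr\<close>, \<open>ks\<close>,
      \<open>kt\<close> and \<open>ku\<close>.\<close>
    show "(r \<oplus>\<^sub>H s) \<cdot> t \<oplus>\<^sub>H r \<cdot> u = s \<cdot> t \<oplus>\<^sub>H r \<cdot> u"
      by (rule K_eq[OF Ob.m_closed[OF o(3,4)] HArr_plus[OF o(3,4) cl(1,3)]
            HArr_plus[OF o(3,4) cl(2,3)] K_plus[OF o(3,4) cl(1,3) m(1,3)]
            K_plus[OF o(3,4) cl(2,3) m(2,3)]])
        (use kH in \<open>simp add: H.m_ac H.idem idem2\<close>)
  qed
  moreover have ?idem
  proof
    fix r assume "r \<in> carrier (Half C)"
    then obtain x where x: "x \<in> Objs C" "r \<in> HArr C x" using Half_carrier by auto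
    then obtain k where k: "k \<in> carrier H" "k \<in> K r" using K_ex by blast
    have "r \<oplus>\<^sub>H r \<in> HArr C x" using HArr_plus[of x x r r] x Ob.idem by simp
    moreover have "k \<in> K (r \<oplus>\<^sub>H r)" using K_plus[of x x r r k k] x k H.idem by simp
    ultimately show "r = r \<oplus>\<^sub>H r" using K_eq x k by blast
  qed
  ultimately show "?loop \<and> ?absorb \<and> ?idem" by blast
next
  assume *: "?loop \<and> ?absorb \<and> ?idem"
  interpret finite_forest_category C by fact
  interpret Ob: idem_comm_monoid "Obj C" by fact
  interpret absorbing_forest_category C
    by unfold_locales (use * in auto)
  have "idem_comm_monoid \<lparr>carrier = UNIV, mult = (\<union>), one = {} :: ('h + 'a) set\<rparr>"
    by unfold_locales (auto simp: Units_def)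
  \<comment> \<open>Finiteness of \<open>C\<close> enters here, to replace the type of label sets by
    \<open>nat\<close>.\<close>
  then show "globally_idem_comm C"
    using globally_idem_comm_if_divides_flat assms(1) divides_flat_sets by blast
qed

end
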